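(* Let $n\ge 2$ be an integer and let $\beta\in\mathbb{R}$ satisfy $\beta\geq \frac{n+1}{2n}$. Then the function $x\mapsto F^{(n)}_{1/n,\beta}(-x)$ is completely monotone on $(0,\infty)$.
   Context: For $\alpha>0$, $\beta\in\mathbb{R}$ and a positive integer $n$, the Mittag-Leffler function of Le Roy type is the entire function $F^{(n)}_{\alpha,\beta}(z)=\sum_{r=0}^{\infty} \frac{z^{r}}{[\Gamma(\beta+\alpha r)]^{n}}$. A function $f:(0,\infty)\to\mathbb{R}$ is completely monotone if it is infinitely differentiable and $(-1)^{j}f^{(j)}(x)\geq 0$ for all $x>0$ and all $j=0,1,2,\ldots$, where $f^{(j)}$ is the $j$-th derivative. *)

theory Defs
  imports "HOL-Analysis.Analysis"
begin

text \<open>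
  Since \<^term>\<open>Gamma\<close> is \<open>0\<close> at its poles and \<open>z / 0 = 0\<close>, for \<open>n > 0\<close> a term with
  \<open>\<beta> + \<alpha> r\<close> a non-positive integer vanishes, as the entire function \<open>1 / \<Gamma>\<close> requires.
  The argument type covers both \<^typ>\<open>real\<close> and \<^typ>\<open>complex\<close>; the coefficients are real.
\<close>

definition le_roy_mittag_leffler :: "nat \<Rightarrow> real \<Rightarrow> real \<Rightarrow> 'a::{real_normed_field,banach} \<Rightarrow> 'a" where
  "le_roy_mittag_leffler n \<alpha> \<beta> z = (\<Sum>r. z ^ r / of_real (Gamma (\<beta> + \<alpha> * real r) ^ n))"

text \<open>
  As \<open>(0,\<infinity>)\<close> is open, iterated two-sided derivatives at \<open>x > 0\<close> depend only on the values of
  \<open>f\<close> on \<open>(0,\<infinity>)\<close>.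
\<close>

definition completely_monotone :: "(real \<Rightarrow> real) \<Rightarrow> bool" where
  "completely_monotone f \<longleftrightarrow>
     (\<forall>j. \<forall>x>0. (deriv ^^ j) f field_differentiable at x) \<and>
     (\<forall>j. \<forall>x>0. (-1) ^ j * (deriv ^^ j) f x \<ge> 0)"

end

theory Submission
  imports Defs
begin

text \<open>
  Up to the factor \<open>(-x)\<^sup>r / r!\<close>, the terms of the series at \<open>-x\<close> are \<open>n\<^sup>r M r\<close> with
  \<open>M r = r! / (n\<^sup>r \<Gamma>(\<beta> + r/n)\<^sup>n)\<close>. By the multiplication formula for \<open>r!\<close>, \<open>M r\<close> is a positive
  multiple of \<open>\<Prod>k=1..n. \<Gamma>((k + r)/n) / \<Gamma>(\<beta> + r/n)\<close>, so by Euler's limit formula it is a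
  limit of products, over \<open>j\<close>, of positive multiples of
  \<open>\<Prod>k. (\<beta> + j + s) / (k/n + j + s)\<close> with \<open>s = r/n\<close>. The numbers \<open>k/n\<close> are symmetric about
  \<open>(n+1)/(2n) \<le> \<beta>\<close>; pairing \<open>k\<close> with \<open>n + 1 - k\<close> shows that each such factor has nonnegative
  alternating differences in \<open>r\<close>, and hence so has \<open>M\<close>. Finally
  \<open>exp y * (\<Sum>r. (-y)\<^sup>r / r! * M r)\<close> is the exponential generating function of the alternating
  differences of \<open>M\<close> at \<open>0\<close>, hence nonnegative, and differentiation in \<open>y\<close> only shifts \<open>-M\<close>.
\<close>

section \<open>Completely monotone sequences\<close>

text \<open>The forward difference is negated so that complete monotonicity carries no sign
  \<open>(-1) ^ k\<close>. By Hausdorff's theorem, \<open>cm_seq\<close> describes the moment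
  sequences of finite positive measures on [0,1].\<close>

definition bdiff :: "(nat \<Rightarrow> real) \<Rightarrow> nat \<Rightarrow> real" where
  "bdiff M r = M r - M (Suc r)"

definition cm_seq :: "(nat \<Rightarrow> real) \<Rightarrow> bool" where
  "cm_seq M \<longleftrightarrow> (\<forall>k r. (bdiff ^^ k) M r \<ge> 0)"

lemma bdiff_funpow_step: "(bdiff ^^ Suc k) M r = (bdiff ^^ k) M r - (bdiff ^^ k) M (Suc r)"
  by (simp add: bdiff_def [of "(bdiff ^^ k) M"])

lemma cm_seq_nonneg: "cm_seq M \<Longrightarrow> M r \<ge> 0"
  unfolding cm_seq_def by (metis funpow_0)

lemma cm_seq_bdiff: "cm_seq M \<Longrightarrow> cm_seq (bdiff M)"
  unfolding cm_seq_def by (metis comp_apply funpow_Suc_right)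

lemma bdiff_funpow_Suc: "(bdiff ^^ k) (\<lambda>r. M (Suc r)) = (\<lambda>r. (bdiff ^^ k) M (Suc r))"
  by (induction k) (auto simp: bdiff_def fun_eq_iff)

lemma cm_seq_Suc: "cm_seq M \<Longrightarrow> cm_seq (\<lambda>r. M (Suc r))"
  by (simp add: cm_seq_def bdiff_funpow_Suc)

lemma cm_seq_shift: "cm_seq M \<Longrightarrow> cm_seq (\<lambda>r. M (r + j))"
proof (induction j)
  case (Suc j)
  then show ?case
    using cm_seq_Suc[of "\<lambda>r. M (r + j)"] by simp
qed simp

lemma cm_seq_le_first:
  assumes "cm_seq M"
  shows "M r \<le> M 0"
proof (induction r)
  case (Suc r)
  then show ?case
    using cm_seq_nonneg[OF cm_seq_bdiff[OF assms], of r] by (simp add: bdiff_def)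
qed simp

lemma bdiff_funpow_add:
  "(bdiff ^^ k) (\<lambda>r. f r + g r) = (\<lambda>r. (bdiff ^^ k) f r + (bdiff ^^ k) g r)"
  by (induction k) (auto simp: bdiff_def fun_eq_iff)

lemma cm_seq_add: "cm_seq f \<Longrightarrow> cm_seq g \<Longrightarrow> cm_seq (\<lambda>r. f r + g r)"
  by (simp add: cm_seq_def bdiff_funpow_add)

lemma cm_seq_const:
  assumes "c \<ge> 0"
  shows "cm_seq (\<lambda>_. c)"
proof -
  have "(bdiff ^^ k) (\<lambda>_. c) = (\<lambda>_. if k = 0 then c else 0)" for k
    by (induction k) (auto simp: bdiff_def fun_eq_iff)
  then show ?thesis
    using assms by (simp add: cm_seq_def)
qed

text \<open>A discrete Leibniz rule writes \<open>bdiff\<close> of the product as a sum of two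
  products of sequences of the same kind, so induction on the order works once \<open>f\<close> and
  \<open>g\<close> are generalised.\<close>

lemma cm_seq_mult:
  assumes "cm_seq f" "cm_seq g"
  shows "cm_seq (\<lambda>r. f r * g r)"
proof -
  have "(bdiff ^^ k) (\<lambda>r. f r * g r) r \<ge> 0" for k r
    using assms
  proof (induction k arbitrary: f g r)
    case 0
    then show ?case by (simp add: cm_seq_nonneg)
  next
    case (Suc k)
    have eq: "bdiff (\<lambda>r. f r * g r) = (\<lambda>r. f r * bdiff g r + bdiff f r * g (Suc r))"
      by (auto simp: bdiff_def algebra_simps)
    have "(bdiff ^^ k) (\<lambda>r. f r * bdiff g r) r \<ge> 0"
      by (intro Suc.IH Suc.prems cm_seq_bdiff)
    moreover have "(bdiff ^^ k) (\<lambda>r. bdiff f r * g (Suc r)) r \<ge> 0"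
      by (intro Suc.IH Suc.prems cm_seq_bdiff cm_seq_Suc)
    ultimately show ?case
      by (simp add: funpow_Suc_right eq bdiff_funpow_add del: funpow.simps)
  qed
  then show ?thesis by (simp add: cm_seq_def)
qed

lemma cm_seq_prod:
  assumes "\<And>i. i \<in> A \<Longrightarrow> cm_seq (f i)"
  shows "cm_seq (\<lambda>r. \<Prod>i\<in>A. f i r)"
  using assms by (induction A rule: infinite_finite_induct) (auto intro!: cm_seq_const cm_seq_mult)

lemma cm_seq_LIMSEQ:
  assumes cm: "\<And>N. cm_seq (f N)" and lim: "\<And>r. (\<lambda>N. f N r) \<longlonglongrightarrow> M r"
  shows "cm_seq M"
proof -
  have "(\<lambda>N. (bdiff ^^ k) (f N) r) \<longlonglongrightarrow> (bdiff ^^ k) M r" for k r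
    by (induction k arbitrary: r) (auto simp: bdiff_def lim intro: tendsto_diff)
  then show ?thesis
    using cm unfolding cm_seq_def by (meson LIMSEQ_le_const)
qed

section \<open>Rational sequences with linear factors\<close>

lemma bdiff_funpow_inverse_linear:
  fixes a h :: real
  assumes "a > 0" "h \<ge> 0"
  shows "(bdiff ^^ k) (\<lambda>r. 1 / (a + h * real r)) r =
    fact k * h ^ k / (\<Prod>i\<le>k. a + h * real (r + i))"
proof (induction k arbitrary: r)
  case (Suc k)
  \<comment> \<open>\<open>P\<close> collects the \<open>k\<close> factors shared by the two
    denominators; after subtraction only the gap \<open>h * (k + 1)\<close> of the two outer factors
    is left.\<close>
  define P where "P = (\<Prod>i<k. a + h * real (Suc r + i))"
  have pos: "a + h * real i > 0" for i
    using assms by (simp add: add_pos_nonneg)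
  have "P > 0"
    unfolding P_def by (intro prod_pos pos)
  have 1: "(\<Prod>i\<le>k. a + h * real (r + i)) = (a + h * real r) * P"
    unfolding P_def by (subst lessThan_Suc_atMost [symmetric], subst prod.lessThan_Suc_shift) simp
  have 2: "(\<Prod>i\<le>k. a + h * real (Suc r + i)) = P * (a + h * real (Suc r + k))"
    unfolding P_def by (subst lessThan_Suc_atMost [symmetric], subst prod.lessThan_Suc) simp
  have 3: "(\<Prod>i\<le>Suc k. a + h * real (r + i)) = (a + h * real r) * P * (a + h * real (Suc r + k))"
    using 1 by simp
  have "(bdiff ^^ Suc k) (\<lambda>r. 1 / (a + h * real r)) r
      = fact k * h ^ k / ((a + h * real r) * P)
        - fact k * h ^ k / (P * (a + h * real (Suc r + k)))"
    by (simp only: bdiff_funpow_step Suc.IH 1 2)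
  also have "\<dots> = fact k * h ^ k * (h * real (Suc k)) / ((a + h * real r) * P * (a + h * real (Suc r + k)))"
    using \<open>P > 0\<close> pos[of r] pos[of "Suc r + k"]
    by (simp add: divide_simps) (simp add: algebra_simps)
  finally show ?case
    by (simp only: 3) (simp add: algebra_simps)
qed simp

lemma cm_seq_inverse_linear:
  fixes a h :: real
  assumes "a > 0" "h \<ge> 0"
  shows "cm_seq (\<lambda>r. 1 / (a + h * real r))"
  unfolding cm_seq_def using assms
  by (auto simp: bdiff_funpow_inverse_linear intro!: divide_nonneg_nonneg prod_nonneg mult_nonneg_nonneg)

lemma cm_seq_linear_quotient:
  fixes a B h :: real
  assumes "a > 0" "h \<ge> 0" "B \<ge> a"
  shows "cm_seq (\<lambda>r. (B + h * real r) / (a + h * real r))"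
proof -
  have eq: "(B + h * real r) / (a + h * real r) = 1 + (B - a) * (1 / (a + h * real r))" for r
    using assms add_pos_nonneg[of a "h * real r"] by (simp add: field_simps)
  show ?thesis
    unfolding eq using assms
    by (intro cm_seq_add cm_seq_mult cm_seq_const cm_seq_inverse_linear) auto
qed

text \<open>For \<open>b > B\<close> and \<open>h > 0\<close> the factor with \<open>b\<close> alone
  is increasing, hence the pairing. With the midpoint \<open>m\<close> and s = \<open>h * r\<close>,
  the identity (m+s)^2 = (a+s)(b+s) + ((a-b)/2)^2 reduces the quotient to sums and products of the
  previous cases.\<close>

lemma cm_seq_quadratic_quotient:
  fixes a b B h :: real
  assumes "a > 0" "b > 0" "h \<ge> 0" "B \<ge> (a + b) / 2"
  shows "cm_seq (\<lambda>r. (B + h * real r)\<^sup>2 / ((a + h * real r) * (b + h * real r)))"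
proof -
  define m where "m = (a + b) / 2"
  have m: "m > 0" "B \<ge> m"
    using assms by (auto simp: m_def)
  have eq: "(B + h * real r)\<^sup>2 / ((a + h * real r) * (b + h * real r)) =
      ((B + h * real r) / (m + h * real r)) * ((B + h * real r) / (m + h * real r)) *
      (1 + ((a - b) / 2)\<^sup>2 * ((1 / (a + h * real r)) * (1 / (b + h * real r))))" for r
  proof -
    define x y where "x = a + h * real r" and "y = b + h * real r"
    have pos: "x > 0" "y > 0" "m + h * real r > 0"
      using assms m by (auto simp: x_def y_def intro: add_pos_nonneg)
    have sq: "(m + h * real r)\<^sup>2 = x * y + ((a - b) / 2)\<^sup>2"
      by (simp add: m_def x_def y_def power2_eq_square field_simps)
    have "1 + ((a - b) / 2)\<^sup>2 * ((1 / x) * (1 / y)) = (m + h * real r)\<^sup>2 / (x * y)"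
      unfolding sq using pos by (simp add: add_divide_distrib)
    then show ?thesis
      unfolding x_def [symmetric] y_def [symmetric]
      using pos by (simp add: power2_eq_square)
  qed
  show ?thesis
    unfolding eq using assms m
    by (intro cm_seq_add cm_seq_mult cm_seq_const cm_seq_inverse_linear cm_seq_linear_quotient) auto
qed

text \<open>Pair the first and last terms of the progression. The inner terms start at
  \<open>a + d\<close> and have the same mean, so the bound on \<open>B\<close> is inherited and the
  induction goes in steps of two.\<close>

lemma cm_seq_arithmetic_quotient:
  fixes a d B h :: real
  assumes "a > 0" "d \<ge> 0" "h \<ge> 0" "B \<ge> a + (real n - 1) * d / 2"
  shows "cm_seq (\<lambda>r. \<Prod>k<n. (B + h * real r) / (a + real k * d + h * real r))"
  using assms
proof (induction n arbitrary: a rule: nat_induct2)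
  case 0
  then show ?case by (simp add: cm_seq_const)
next
  case 1
  then show ?case by (simp add: cm_seq_linear_quotient)
next
  case (step n)
  let ?b = "a + real (Suc n) * d"
  have eq: "(\<Prod>k<n + 2. (B + h * real r) / (a + real k * d + h * real r)) =
      (B + h * real r)\<^sup>2 / ((a + h * real r) * (?b + h * real r)) *
      (\<Prod>k<n. (B + h * real r) / ((a + d) + real k * d + h * real r))" for r
  proof -
    have "(\<Prod>k<n + 2. (B + h * real r) / (a + real k * d + h * real r)) =
       (\<Prod>k<Suc n. (B + h * real r) / (a + real k * d + h * real r)) *
       ((B + h * real r) / (?b + h * real r))"
      by simp
    also have "(\<Prod>k<Suc n. (B + h * real r) / (a + real k * d + h * real r)) =
       (B + h * real r) / (a + h * real r) *
       (\<Prod>k<n. (B + h * real r) / ((a + d) + real k * d + h * real r))"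
      by (subst prod.lessThan_Suc_shift) (simp add: algebra_simps)
    finally show ?thesis
      by (simp add: power2_eq_square)
  qed
  have "?b > 0"
    using step.prems by (simp add: add_pos_nonneg)
  then show ?case
    unfolding eq using step.prems
    by (intro cm_seq_mult cm_seq_quadratic_quotient step.IH) (auto simp: field_simps)
qed

section \<open>Exponential generating functions\<close>

text \<open>If \<open>M\<close> is the moment sequence of a measure \<mu> on [0,1], this is the
  integral of exp(-cxt) against \<mu>. The powers of \<open>x\<close> stand apart so that termwise
  differentiation applies.\<close>

definition alt_egf :: "real \<Rightarrow> (nat \<Rightarrow> real) \<Rightarrow> real \<Rightarrow> real" where
  "alt_egf c M x = (\<Sum>r. ((- c) ^ r / fact r * M r) * x ^ r)"

lemma bdiff_funpow_binomial:
  "(bdiff ^^ m) M p = (\<Sum>i\<le>m. (-1) ^ i * real (m choose i) * M (p + i))"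
proof (induction m arbitrary: p)
  case (Suc m)
  have "(\<Sum>i\<le>Suc m. (-1) ^ i * real (Suc m choose i) * M (p + i))
     = M p + (\<Sum>i\<le>m. (-1) ^ Suc i * real (m choose Suc i) * M (p + Suc i))
        - (\<Sum>i\<le>m. (-1) ^ i * real (m choose i) * M (Suc p + i))"
    by (subst sum.atMost_Suc_shift) (simp add: algebra_simps sum.distrib sum_negf sum_subtractf)
  also have "M p + (\<Sum>i\<le>m. (-1) ^ Suc i * real (m choose Suc i) * M (p + Suc i))
      = (\<Sum>i\<le>Suc m. (-1) ^ i * real (m choose i) * M (p + i))"
    by (subst sum.atMost_Suc_shift) simp
  also have "\<dots> = (\<Sum>i\<le>m. (-1) ^ i * real (m choose i) * M (p + i))"
    by (simp add: binomial_eq_0)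
  finally show ?case
    by (simp only: bdiff_funpow_step Suc.IH)
qed simp

text \<open>Since 0 \<le> \<open>M r\<close> \<le> \<open>M 0\<close>, the exponential series
  dominates for every \<open>x\<close>; this serves both the Cauchy product and termwise
  differentiation.\<close>

lemma summable_norm_alt_egf:
  assumes "cm_seq M"
  shows "summable (\<lambda>r. norm (((- c) ^ r / fact r * M r) * x ^ r))"
proof (rule summable_comparison_test)
  show "summable (\<lambda>r. M 0 * (\<bar>c * x\<bar> ^ r / fact r))"
    using summable_exp[of "\<bar>c * x\<bar>"] by (intro summable_mult) (simp add: field_simps)
  have "\<bar>c * x\<bar> ^ r / fact r * M r \<le> \<bar>c * x\<bar> ^ r / fact r * M 0" for r
    using cm_seq_le_first[OF assms] by (intro mult_left_mono) auto
  then show "\<exists>N. \<forall>r\<ge>N. norm (norm (((- c) ^ r / fact r * M r) * x ^ r))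
      \<le> M 0 * (\<bar>c * x\<bar> ^ r / fact r)"
    using cm_seq_nonneg[OF assms]
    by (auto simp: abs_mult power_abs power_mult_distrib mult_ac)
qed

lemma alt_egf_nonneg:
  assumes "cm_seq M" "c \<ge> 0" "x \<ge> 0"
  shows "alt_egf c M x \<ge> 0"
proof -
  define y where "y = c * x"
  have y: "y \<ge> 0"
    using assms by (simp add: y_def)
  define a where "a = (\<lambda>r. ((- c) ^ r / fact r * M r) * x ^ r)"
  \<comment> \<open>The series of exp(cx): its Cauchy product with \<open>a\<close> produces exactly
    the binomial sums of \<open>bdiff_funpow_binomial\<close>.\<close>
  define b where "b = (\<lambda>r. y ^ r / fact r)"
  have conv: "(\<Sum>i\<le>m. a i * b (m - i)) = y ^ m / fact m * (bdiff ^^ m) M 0" for m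
  proof -
    have "a i * b (m - i) = y ^ m / fact m * ((-1) ^ i * real (m choose i) * M i)" if "i \<le> m" for i
    proof -
      have "(- c) ^ i * x ^ i = (-1) ^ i * y ^ i"
        by (simp add: y_def flip: power_mult_distrib)
      moreover have "y ^ m = y ^ i * y ^ (m - i)"
        using that by (simp flip: power_add)
      ultimately show ?thesis
        using that by (simp add: a_def b_def binomial_fact field_simps)
    qed
    then show ?thesis
      by (simp add: bdiff_funpow_binomial sum_distrib_left)
  qed
  have "(\<lambda>m. \<Sum>i\<le>m. a i * b (m - i)) sums (alt_egf c M x * (\<Sum>r. b r))"
    unfolding alt_egf_def a_def [symmetric]
  proof (rule Cauchy_product_sums)
    show "summable (\<lambda>r. norm (a r))"
      unfolding a_def by (rule summable_norm_alt_egf) fact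
    show "summable (\<lambda>r. norm (b r))"
      using summable_exp[of y] y by (simp add: b_def field_simps)
  qed
  moreover have "(\<Sum>r. b r) = exp y"
    by (simp add: b_def exp_def field_simps scaleR_conv_of_real)
  ultimately have sums: "(\<lambda>m. y ^ m / fact m * (bdiff ^^ m) M 0) sums (alt_egf c M x * exp y)"
    by (simp add: conv)
  have "y ^ m / fact m * (bdiff ^^ m) M 0 \<ge> 0" for m
    using y assms(1) unfolding cm_seq_def by (intro mult_nonneg_nonneg divide_nonneg_nonneg) auto
  then have "alt_egf c M x * exp y \<ge> 0"
    by (rule sums_le [OF _ sums_zero sums])
  then show ?thesis
    by (simp add: zero_le_mult_iff)
qed

lemma has_field_derivative_alt_egf:
  assumes "cm_seq M"
  shows "(alt_egf c M has_field_derivative - c * alt_egf c (\<lambda>r. M (Suc r)) x) (at x)"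
proof -
  define a where "a = (\<lambda>r. (- c) ^ r / fact r * M r)"
  have "((\<lambda>x. \<Sum>r. a r * x ^ r) has_field_derivative (\<Sum>r. diffs a r * x ^ r)) (at x)"
    unfolding a_def
    by (rule termdiffs_strong_converges_everywhere)
      (rule summable_norm_cancel, rule summable_norm_alt_egf [OF assms])
  moreover have "(\<Sum>r. diffs a r * x ^ r) = - c * alt_egf c (\<lambda>r. M (Suc r)) x"
  proof -
    have "diffs a r * x ^ r = - c * (((- c) ^ r / fact r * M (Suc r)) * x ^ r)" for r
      by (simp add: a_def diffs_def divide_simps del: of_nat_Suc)
    then show ?thesis
      using suminf_mult [OF summable_norm_cancel [OF summable_norm_alt_egf [OF cm_seq_Suc [OF assms]]], of "- c" c x]
      by (simp only: alt_egf_def)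
  qed
  moreover have "(\<lambda>x. \<Sum>r. a r * x ^ r) = alt_egf c M"
    by (simp add: fun_eq_iff alt_egf_def a_def)
  ultimately show ?thesis by simp
qed

lemma deriv_funpow_alt_egf:
  assumes "cm_seq M"
  shows "(deriv ^^ j) (alt_egf c M) = (\<lambda>x. (- c) ^ j * alt_egf c (\<lambda>r. M (r + j)) x)"
proof (induction j)
  case (Suc j)
  have "((\<lambda>x. (- c) ^ j * alt_egf c (\<lambda>r. M (r + j)) x) has_field_derivative
     (- c) ^ Suc j * alt_egf c (\<lambda>r. M (r + Suc j)) x) (at x)" for x
    using DERIV_cmult [OF has_field_derivative_alt_egf [OF cm_seq_shift [OF assms]],
        of "(- c) ^ j" c j x]
    by (simp add: mult_ac)
  from DERIV_imp_deriv [OF this] show ?case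
    by (simp add: Suc.IH fun_eq_iff)
qed simp

lemma completely_monotone_alt_egf:
  assumes "cm_seq M" "c \<ge> 0"
  shows "completely_monotone (alt_egf c M)"
proof -
  have cm: "cm_seq (\<lambda>r. M (r + j))" for j
    by (rule cm_seq_shift) fact
  have "(\<lambda>x. (- c) ^ j * alt_egf c (\<lambda>r. M (r + j)) x) field_differentiable at x" for j x
    using DERIV_cmult [OF has_field_derivative_alt_egf [OF cm]] unfolding field_differentiable_def
    by blast
  moreover have "(-1) ^ j * ((- c) ^ j * alt_egf c (\<lambda>r. M (r + j)) x) \<ge> 0" if "x > 0" for j x
    using alt_egf_nonneg [OF cm assms(2), of x] that assms(2)
    by (simp flip: mult.assoc power_mult_distrib)
  ultimately show ?thesis
    by (simp add: completely_monotone_def deriv_funpow_alt_egf [OF assms(1)])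
qed

section \<open>Quotients of Gamma functions\<close>

text \<open>Gauss's multiplication formula at integers, with its constant left as the product at
  \<open>r = 0\<close>. Increasing \<open>r\<close> by one slides the window of \<open>n\<close>
  arguments by 1/n.\<close>

lemma prod_Gamma_eq_fact:
  assumes "n > 0"
  shows "(\<Prod>k<n. Gamma (real (Suc k + r) / real n)) =
    (\<Prod>k<n. Gamma (real (Suc k) / real n)) * fact r / real n ^ r"
proof (induction r)
  case (Suc r)
  let ?g = "\<lambda>k. Gamma (real (Suc k + r) / real n)"
  obtain m where m: "n = Suc m"
    using assms by (cases n) auto
  have "(\<Prod>k<n. Gamma (real (Suc k + Suc r) / real n)) = (\<Prod>k<m. ?g (Suc k)) * ?g n"
    by (simp add: m add_ac)
  \<comment> \<open>The entering factor \<open>?g n\<close> has argument one larger than the leaving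
    factor \<open>?g 0\<close>, so the functional equation of \<Gamma> relates them.\<close>
  also have "?g n = Gamma (real (Suc r) / real n + 1)"
    using assms by (simp add: field_simps)
  also have "\<dots> = real (Suc r) / real n * ?g 0"
  proof (subst Gamma_plus1)
    have "real (Suc r) / real n > 0"
      using assms by simp
    then show "real (Suc r) / real n \<notin> \<int>\<^sub>\<le>\<^sub>0"
      by (meson nonpos_Ints_nonpos not_le)
  qed simp
  also have "(\<Prod>k<m. ?g (Suc k)) * (real (Suc r) / real n * ?g 0) =
      real (Suc r) / real n * (\<Prod>k<n. ?g k)"
    unfolding m by (subst prod.lessThan_Suc_shift) (simp add: mult_ac)
  also have "\<dots> = (\<Prod>k<n. Gamma (real (Suc k) / real n)) * fact (Suc r) / real n ^ Suc r"
    unfolding Suc.IH by (simp add: mult_ac del: of_nat_Suc)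
  finally show ?case .
qed simp

lemma cm_seq_Gamma_quotient:
  fixes a d h \<beta> :: real
  assumes "a > 0" "d \<ge> 0" "h \<ge> 0" "\<beta> \<ge> a + (real n - 1) * d / 2" "\<beta> > 0"
  shows "cm_seq (\<lambda>r. \<Prod>k<n. Gamma (a + real k * d + h * real r) / Gamma (\<beta> + h * real r))"
proof (rule cm_seq_LIMSEQ)
  fix r
  have "\<beta> + h * real r > 0"
    using assms by (simp add: add_pos_nonneg)
  then have "Gamma (\<beta> + h * real r) \<noteq> 0"
    by (metis Gamma_real_pos less_irrefl)
  then show "(\<lambda>N. \<Prod>k<n. Gamma_series (a + real k * d + h * real r) N / Gamma_series (\<beta> + h * real r) N)
      \<longlonglongrightarrow> (\<Prod>k<n. Gamma (a + real k * d + h * real r) / Gamma (\<beta> + h * real r))"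
    by (intro tendsto_intros)
next
  fix N
  \<comment> \<open>In the quotient, \<open>fact N\<close> and \<open>exp (s * ln N)\<close> cancel:
    what depends on \<open>s\<close> is rational, and the remaining exponential is a positive
    constant.\<close>
  have eq: "Gamma_series (x + s) N / Gamma_series (\<beta> + s) N =
      exp ((x - \<beta>) * ln (real N)) * (\<Prod>j\<le>N. (\<beta> + real j + s) / (x + real j + s))"
    for x s
  proof -
    have "exp ((x + s) * ln (real N)) = exp ((x - \<beta>) * ln (real N)) * exp ((\<beta> + s) * ln (real N))"
      by (simp add: algebra_simps flip: exp_add)
    then show ?thesis
      by (simp add: Gamma_series_def pochhammer_prod atLeast0LessThan lessThan_Suc_atMost
          prod_dividef add_ac)
  qed
  have "(\<Prod>k<n. Gamma_series (a + real k * d + h * real r) N / Gamma_series (\<beta> + h * real r) N) =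
      (\<Prod>k<n. exp ((a + real k * d - \<beta>) * ln (real N))) *
      (\<Prod>j\<le>N. \<Prod>k<n. ((\<beta> + real j) + h * real r) / ((a + real j) + real k * d + h * real r))" for r
    unfolding eq prod.distrib by (subst prod.swap) (simp add: add_ac)
  \<comment> \<open>Adding \<open>j\<close> to both \<open>a\<close> and \<beta> preserves the bound
    on the mean.\<close>
  moreover have "cm_seq (\<lambda>r. (\<Prod>k<n. exp ((a + real k * d - \<beta>) * ln (real N))) *
      (\<Prod>j\<le>N. \<Prod>k<n. ((\<beta> + real j) + h * real r) / ((a + real j) + real k * d + h * real r)))"
    using assms
    by (intro cm_seq_mult cm_seq_const cm_seq_prod cm_seq_arithmetic_quotient prod_nonneg)
      (auto simp: add_pos_nonneg)
  ultimately show "cm_seq (\<lambda>r. \<Prod>k<n. Gamma_series (a + real k * d + h * real r) N / Gamma_series (\<beta> + h * real r) N)"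
    by simp
qed

section \<open>The Le Roy coefficients\<close>

lemma cm_seq_le_roy:
  assumes "n > 0" "\<beta> \<ge> (real n + 1) / (2 * real n)"
  shows "cm_seq (\<lambda>r. fact r / (real n ^ r * Gamma (\<beta> + 1 / real n * real r) ^ n))"
proof -
  define C where "C = (\<Prod>k<n. Gamma (real (Suc k) / real n))"
  have "C > 0"
    unfolding C_def using assms by (intro prod_pos) (auto intro!: Gamma_real_pos)
  have "(real n + 1) / (2 * real n) > 0"
    using assms by simp
  then have "\<beta> > 0"
    using assms(2) by linarith
  \<comment> \<open>The mean of 1/n, 2/n, ..., n/n, the progression with \<open>a = d = 1/n\<close>,
    is the assumed lower bound on \<beta>.\<close>
  have "1 / real n + (real n - 1) * (1 / real n) / 2 = (real n + 1) / (2 * real n)"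
    using assms(1) by (simp add: field_simps)
  then have cm: "cm_seq (\<lambda>r. 1 / C * (\<Prod>k<n. Gamma (1 / real n + real k * (1 / real n) + 1 / real n * real r)
      / Gamma (\<beta> + 1 / real n * real r)))"
    using \<open>C > 0\<close> \<open>\<beta> > 0\<close> assms by (intro cm_seq_mult cm_seq_const cm_seq_Gamma_quotient) auto
  have "(\<Prod>k<n. Gamma (1 / real n + real k * (1 / real n) + 1 / real n * real r)) =
      C * fact r / real n ^ r" for r
    unfolding C_def prod_Gamma_eq_fact [OF assms(1), symmetric]
    by (intro prod.cong refl arg_cong[of _ _ Gamma]) (use assms in \<open>simp add: field_simps\<close>)
  then show ?thesis
    using cm \<open>C > 0\<close> by (simp add: prod_dividef)
qed

theorem mainTheorem2:
  fixes n :: nat and \<beta> :: real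
  assumes "n \<ge> 2"
    and "\<beta> \<ge> (real n + 1) / (2 * real n)"
  shows "completely_monotone (\<lambda>x. le_roy_mittag_leffler n (1 / real n) \<beta> (- x))"
proof -
  \<comment> \<open>The scale \<open>c = n\<close> in \<open>alt_egf\<close> cancels the power
    \<open>n ^ r\<close> that the multiplication formula puts into \<open>?M\<close>.\<close>
  let ?M = "\<lambda>r. fact r / (real n ^ r * Gamma (\<beta> + 1 / real n * real r) ^ n)"
  have "(- x) ^ r / Gamma (\<beta> + 1 / real n * real r) ^ n = ((- real n) ^ r / fact r * ?M r) * x ^ r"
    for x r
    using assms(1) by (simp add: power_minus[of x] power_minus[of "real n"])
  then have "(\<lambda>x. le_roy_mittag_leffler n (1 / real n) \<beta> (- x)) = alt_egf (real n) ?M"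
    by (simp add: fun_eq_iff le_roy_mittag_leffler_def alt_egf_def)
  moreover have "cm_seq ?M"
    using assms by (intro cm_seq_le_roy) auto
  ultimately show ?thesis
    by (simp add: completely_monotone_alt_egf)
qed

end
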